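(* Let $\lambda(z)\,|dz|$ and $\mu(z)\,|dz|$ be conformal pseudometrics on the unit disk $\mathbb{D}$ such that $\kappa_\mu=\kappa$ for some locally H\"older continuous function $\kappa:\mathbb{D}\to\mathbb{R}$ with $-c\le\kappa(z)\le -4$ in $\mathbb{D}$ for some $c>0$. Suppose $\lambda\preceq\mu$ and $$\frac{\lambda(z_n)}{\mu(z_n)}=1+o\big((1-|z_n|)^{c/2}\big)$$ for some sequence $(z_n)$ in $\mathbb{D}$ such that $|z_n|\to 1$. Then $\lambda=\mu$.
   Context: A conformal pseudometric $\lambda(z)\,|dz|$ on a domain $G\subset\mathbb{C}$ is a continuous function $\lambda:G\to[0,\infty)$ which is of class $C^2$ on $\{\lambda>0\}$; its curvature $\kappa_\lambda(z)=-\Delta(\log\lambda)(z)/\lambda(z)^2$ is defined where $\lambda(z)>0$, and (in)equalities for $\kappa_\lambda$ are understood at all points with $\lambda(z)>0$. One writes $\lambda\preceq\mu$ ($\lambda$ is dominated by $\mu$) on $G$ if (i) $\kappa_\lambda\le\kappa_\mu$ in $G$, and (ii) $\mu$ has only isolated zeros in $G$ and $\lambda/\mu$ has a continuous extension from $\{z\in G:\mu(z)\ne 0\}$ to $G$ with values in $[0,1]$. If $\lambda\preceq\mu$, then $\lambda(z)/\mu(z)$ denotes the value of this continuous extension at any $z\in G$. *)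

theory Defs
  imports "HOL-Analysis.Analysis" "HOL-Library.Landau_Symbols"
begin

definition dir_deriv :: "complex \<Rightarrow> (complex \<Rightarrow> real) \<Rightarrow> complex \<Rightarrow> real" where
  "dir_deriv v f z = frechet_derivative f (at z) v"

text \<open>
  \<open>Basis\<close> of the real inner product space \<^typ>\<open>complex\<close> is \<open>{1, \<i>}\<close>, so \<open>dir_deriv b\<close> for
  \<open>b \<in> Basis\<close> are the real partial derivatives in \<open>x\<close> and \<open>y\<close>.
  Both \<open>C2_on\<close> and \<open>laplacian\<close> are meant for functions on open sets.
\<close>

definition C2_on :: "complex set \<Rightarrow> (complex \<Rightarrow> real) \<Rightarrow> bool" where
  "C2_on S f \<longleftrightarrow>
     f differentiable_on S \<and>
     (\<forall>b\<in>Basis. dir_deriv b f differentiable_on S) \<and>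
     (\<forall>a\<in>Basis. \<forall>b\<in>Basis. continuous_on S (dir_deriv a (dir_deriv b f)))"

definition laplacian :: "(complex \<Rightarrow> real) \<Rightarrow> complex \<Rightarrow> real" where
  "laplacian f z = (\<Sum>b\<in>Basis. dir_deriv b (dir_deriv b f) z)"

definition conformal_pseudometric :: "complex set \<Rightarrow> (complex \<Rightarrow> real) \<Rightarrow> bool" where
  "conformal_pseudometric G l \<longleftrightarrow>
     open G \<and> connected G \<and> G \<noteq> {} \<and>
     continuous_on G l \<and> (\<forall>z\<in>G. 0 \<le> l z) \<and> C2_on {z\<in>G. 0 < l z} l"

text \<open>Only meaningful at points where \<open>l\<close> is positive.\<close>

definition curvature :: "(complex \<Rightarrow> real) \<Rightarrow> complex \<Rightarrow> real" where
  "curvature l z = - laplacian (\<lambda>w. ln (l w)) z / (l z)\<^sup>2"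

definition is_quotient_extension ::
  "complex set \<Rightarrow> (complex \<Rightarrow> real) \<Rightarrow> (complex \<Rightarrow> real) \<Rightarrow> (complex \<Rightarrow> real) \<Rightarrow> bool" where
  "is_quotient_extension G l m q \<longleftrightarrow>
     continuous_on G q \<and> q ` G \<subseteq> {0..1} \<and> (\<forall>z\<in>G. m z \<noteq> 0 \<longrightarrow> q z = l z / m z)"

text \<open>
  In the curvature inequality both curvatures have to be defined. Under the remaining
  clauses, \<open>0 < l z\<close> already implies \<open>0 < m z\<close>.
\<close>

definition dominated_on :: "complex set \<Rightarrow> (complex \<Rightarrow> real) \<Rightarrow> (complex \<Rightarrow> real) \<Rightarrow> bool" where
  "dominated_on G l m \<longleftrightarrow>
     (\<forall>z\<in>G. 0 < l z \<and> 0 < m z \<longrightarrow> curvature l z \<le> curvature m z) \<and>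
     discrete {z\<in>G. m z = 0} \<and>
     (\<exists>q. is_quotient_extension G l m q)"

text \<open>
  The value of the continuous extension of \<open>l / m\<close>. The choice is determined on \<open>G\<close> when
  \<open>l\<close> is dominated by \<open>m\<close> and \<open>G\<close> is open, see \<open>quotient_ext_eq\<close> below.
\<close>

definition quotient_ext ::
  "complex set \<Rightarrow> (complex \<Rightarrow> real) \<Rightarrow> (complex \<Rightarrow> real) \<Rightarrow> complex \<Rightarrow> real" where
  "quotient_ext G l m = (SOME q. is_quotient_extension G l m q)"

definition locally_Holder_on :: "complex set \<Rightarrow> (complex \<Rightarrow> real) \<Rightarrow> bool" where
  "locally_Holder_on S f \<longleftrightarrow>
     (\<forall>z\<in>S. \<exists>r>0. \<exists>C. \<exists>\<alpha>. 0 < \<alpha> \<and> \<alpha> \<le> 1 \<and>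
        (\<forall>x\<in>ball z r \<inter> S. \<forall>y\<in>ball z r \<inter> S. \<bar>f x - f y\<bar> \<le> C * dist x y powr \<alpha>))"

lemma quotient_extension_unique:
  assumes "open G" "discrete {z\<in>G. m z = 0}"
    and p: "is_quotient_extension G l m p" and q: "is_quotient_extension G l m q"
    and "z \<in> G"
  shows "p z = q z"
proof (cases "m z = 0")
  case True
  with assms have "z isolated_in {z\<in>G. m z = 0}"
    by (auto dest: discreteD)
  then obtain T where T: "open T" "T \<inter> {z\<in>G. m z = 0} = {z}"
    by (auto elim: isolated_inE)
  have "eventually (\<lambda>w. w \<in> T \<inter> G) (at z)"
    using T assms by (intro eventually_at_in_open') auto
  moreover have "eventually (\<lambda>w. w \<noteq> z) (at z)"
    by (simp add: eventually_at_filter)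
  ultimately have "eventually (\<lambda>w. p w = q w) (at z)"
  proof eventually_elim
    case (elim w)
    with T have "m w \<noteq> 0" by auto
    with elim p q show ?case by (simp add: is_quotient_extension_def)
  qed
  moreover have "(p \<longlongrightarrow> p z) (at z)" "(q \<longlongrightarrow> q z) (at z)"
    using p q assms unfolding is_quotient_extension_def
    by (metis continuous_on_eq_continuous_at isCont_def)+
  ultimately show ?thesis
    by (metis tendsto_cong tendsto_unique at_neq_bot)
next
  case False
  with assms show ?thesis by (simp add: is_quotient_extension_def)
qed

lemma quotient_ext_eq:
  assumes "open G" "dominated_on G l m" "is_quotient_extension G l m q" "z \<in> G"
  shows "quotient_ext G l m z = q z"
proof -
  have "is_quotient_extension G l m (quotient_ext G l m)"
    unfolding quotient_ext_def by (rule someI[of "is_quotient_extension G l m", OF assms(3)])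
  with assms show ?thesis
    by (intro quotient_extension_unique[of G m l]) (auto simp: dominated_on_def)
qed

end

theory Submission
  imports Defs
begin

text \<open>
  Write \<open>q = lam / mu\<close> and \<open>u = - ln q \<ge> 0\<close>. The curvature inequality and \<open>1 - q\<^sup>2 \<le> 2 u\<close> give
  \<open>\<Delta>u \<le> 2 m u\<close> with \<open>m = c / (1 - |z|\<^sup>2)\<^sup>2\<close>, since Ahlfors' lemma bounds \<open>mu\<close> by
  \<open>1 / (1 - |z|\<^sup>2)\<close>. Functions \<open>v\<close> with \<open>\<Delta>v \<ge> 2 m v\<close> where \<open>v > 0\<close> can therefore be compared with \<open>u\<close>.
  The barrier \<open>exp (- \<alpha> |z - y|\<^sup>2)\<close> shows that \<open>u\<close> is either identically zero or positive
  everywhere. In the latter case the barrier \<open>s\<^sup>a + 2 s\<^sup>a\<^sup>+\<^sup>1\<close>, where \<open>s = 1 - |z|\<^sup>2\<close> and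
  \<open>a = c / 2 \<ge> 2\<close>, shows that \<open>u\<close> is at least a constant times \<open>(1 - |z|)\<^sup>c\<^sup>/\<^sup>2\<close> near the unit
  circle, which contradicts the assumed decay along \<open>z\<^sub>n\<close>.
\<close>

section \<open>Second derivatives along lines\<close>

text \<open>
  Being a condition on restrictions to lines only, this reduces the barriers to calculus in one
  real variable.
\<close>

definition has_dir_deriv2 :: "complex \<Rightarrow> (complex \<Rightarrow> real) \<Rightarrow> complex \<Rightarrow> real \<Rightarrow> bool" where
  "has_dir_deriv2 b f z d \<longleftrightarrow>
     (\<exists>g. (\<forall>\<^sub>F t in nhds 0. ((\<lambda>t. f (z + of_real t * b)) has_real_derivative g t) (at t)) \<and>
          (g has_real_derivative d) (at 0))"

text \<open>Unlike \<open>laplacian\<close>, which is total, this relation includes existence of the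
  derivatives, so sums and multiples need no separate differentiability hypotheses.\<close>

definition has_laplacian :: "(complex \<Rightarrow> real) \<Rightarrow> complex \<Rightarrow> real \<Rightarrow> bool" where
  "has_laplacian f z L \<longleftrightarrow>
     (\<exists>d1 d2. has_dir_deriv2 1 f z d1 \<and> has_dir_deriv2 \<i> f z d2 \<and> L = d1 + d2)"

section \<open>Linearity of the line-based Laplacian\<close>

lemma has_dir_deriv2I:
  assumes "\<forall>\<^sub>F t in nhds 0. ((\<lambda>t. f (z + of_real t * b)) has_real_derivative g t) (at t)"
    and "(g has_real_derivative d) (at 0)"
  shows "has_dir_deriv2 b f z d"
  unfolding has_dir_deriv2_def by (intro exI[of _ g] conjI assms)

lemma has_dir_deriv2_add:
  assumes "has_dir_deriv2 b f z d" "has_dir_deriv2 b f' z d'"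
  shows "has_dir_deriv2 b (\<lambda>w. f w + f' w) z (d + d')"
proof -
  obtain g g' where
    g: "\<forall>\<^sub>F t in nhds 0. ((\<lambda>t. f (z + of_real t * b)) has_real_derivative g t) (at t)"
       "(g has_real_derivative d) (at 0)" and
    g': "\<forall>\<^sub>F t in nhds 0. ((\<lambda>t. f' (z + of_real t * b)) has_real_derivative g' t) (at t)"
       "(g' has_real_derivative d') (at 0)"
    using assms unfolding has_dir_deriv2_def by blast
  have "\<forall>\<^sub>F t in nhds 0.
      ((\<lambda>t. f (z + of_real t * b) + f' (z + of_real t * b)) has_real_derivative g t + g' t) (at t)"
    using g(1) g'(1) by eventually_elim (rule DERIV_add)
  moreover have "((\<lambda>t. g t + g' t) has_real_derivative d + d') (at 0)"
    using g(2) g'(2) by (rule DERIV_add)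
  ultimately show ?thesis
    by (rule has_dir_deriv2I)
qed

lemma has_dir_deriv2_cmult:
  assumes "has_dir_deriv2 b f z d"
  shows "has_dir_deriv2 b (\<lambda>w. k * f w) z (k * d)"
proof -
  obtain g where
    g: "\<forall>\<^sub>F t in nhds 0. ((\<lambda>t. f (z + of_real t * b)) has_real_derivative g t) (at t)"
       "(g has_real_derivative d) (at 0)"
    using assms unfolding has_dir_deriv2_def by blast
  have "\<forall>\<^sub>F t in nhds 0.
      ((\<lambda>t. k * f (z + of_real t * b)) has_real_derivative k * g t) (at t)"
    using g(1) by eventually_elim (rule DERIV_cmult)
  moreover have "((\<lambda>t. k * g t) has_real_derivative k * d) (at 0)"
    using g(2) by (rule DERIV_cmult)
  ultimately show ?thesis
    by (rule has_dir_deriv2I)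
qed

lemma has_laplacianI:
  assumes "has_dir_deriv2 1 f z d1" "has_dir_deriv2 \<i> f z d2" "L = d1 + d2"
  shows "has_laplacian f z L"
  unfolding has_laplacian_def by (intro exI[of _ d1] exI[of _ d2] conjI assms)

lemma has_laplacianE:
  assumes "has_laplacian f z L"
  obtains d1 d2 where "has_dir_deriv2 1 f z d1" "has_dir_deriv2 \<i> f z d2" "L = d1 + d2"
  using assms unfolding has_laplacian_def by blast

lemma has_laplacian_add:
  assumes "has_laplacian f z L" "has_laplacian f' z L'"
  shows "has_laplacian (\<lambda>w. f w + f' w) z (L + L')"
proof -
  obtain d1 d2 where d: "has_dir_deriv2 1 f z d1" "has_dir_deriv2 \<i> f z d2" "L = d1 + d2"
    using assms(1) by (rule has_laplacianE)
  obtain d1' d2' where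
    d': "has_dir_deriv2 1 f' z d1'" "has_dir_deriv2 \<i> f' z d2'" "L' = d1' + d2'"
    using assms(2) by (rule has_laplacianE)
  show ?thesis
    by (rule has_laplacianI[OF has_dir_deriv2_add[OF d(1) d'(1)] has_dir_deriv2_add[OF d(2) d'(2)]])
      (simp add: d d')
qed

lemma has_laplacian_cmult:
  assumes "has_laplacian f z L"
  shows "has_laplacian (\<lambda>w. k * f w) z (k * L)"
proof -
  obtain d1 d2 where d: "has_dir_deriv2 1 f z d1" "has_dir_deriv2 \<i> f z d2" "L = d1 + d2"
    using assms by (rule has_laplacianE)
  show ?thesis
    by (rule has_laplacianI[OF d(1,2)[THEN has_dir_deriv2_cmult]]) (simp add: d distrib_left)
qed

lemma has_laplacian_diff:
  assumes "has_laplacian f z L" "has_laplacian f' z L'"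
  shows "has_laplacian (\<lambda>w. f w - f' w) z (L - L')"
  using has_laplacian_add[OF assms(1) has_laplacian_cmult[OF assms(2), of "-1"]] by simp

lemma has_laplacian_const: "has_laplacian (\<lambda>_. k) z 0"
proof -
  have "has_dir_deriv2 b (\<lambda>_. k) z 0" for b
    by (rule has_dir_deriv2I[of _ _ _ "\<lambda>_. 0"]) simp_all
  from has_laplacianI[OF this this, of 0] show ?thesis
    by simp
qed

lemma has_laplacian_sum:
  assumes "finite J" "\<And>j. j \<in> J \<Longrightarrow> has_laplacian (f j) z (L j)"
  shows "has_laplacian (\<lambda>w. \<Sum>j\<in>J. f j w) z (\<Sum>j\<in>J. L j)"
  using assms
proof (induction J rule: finite_induct)
  case empty
  show ?case by (simp add: has_laplacian_const)
next
  case (insert j J)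
  have "has_laplacian (\<lambda>w. f j w + (\<Sum>j\<in>J. f j w)) z (L j + (\<Sum>j\<in>J. L j))"
    using insert by (intro has_laplacian_add) simp_all
  with insert show ?case by simp
qed

text \<open>At a local maximum the slope \<open>g 0\<close> vanishes. If \<open>d\<close> were
  positive, \<open>g\<close> would be positive just to the right of 0, and the mean value theorem
  would give values of \<open>f\<close> along the line exceeding \<open>f z\<close>.\<close>

lemma has_dir_deriv2_local_max:
  assumes "has_dir_deriv2 b f z d" "\<forall>\<^sub>F w in nhds z. f w \<le> f z"
  shows "d \<le> 0"
proof (rule ccontr)
  assume "\<not> d \<le> 0"
  then have "d > 0" by simp
  define \<phi> where "\<phi> t = f (z + of_real t * b)" for t :: real
  obtain g where
    g: "\<forall>\<^sub>F t in nhds 0. (\<phi> has_real_derivative g t) (at t)"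
       "(g has_real_derivative d) (at 0)"
    using assms(1) unfolding has_dir_deriv2_def \<phi>_def by blast
  have "((\<lambda>t. z + of_real t * b) \<longlongrightarrow> z + of_real 0 * b) (nhds (0::real))"
    by (intro tendsto_intros filterlim_ident)
  then have "filterlim (\<lambda>t. z + of_real t * b) (nhds z) (nhds (0::real))"
    by simp
  with assms(2) have "\<forall>\<^sub>F t in nhds 0. f (z + of_real t * b) \<le> f z"
    by (rule eventually_compose_filterlim)
  then have "\<forall>\<^sub>F t in nhds 0. \<phi> t \<le> \<phi> 0"
    by (simp add: \<phi>_def)
  then have "\<forall>\<^sub>F t in nhds 0. (\<phi> has_real_derivative g t) (at t) \<and> \<phi> t \<le> \<phi> 0"
    using g(1) by (simp add: eventually_conj)
  then obtain e where e: "e > 0"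
    "\<And>t. dist t 0 < e \<Longrightarrow> (\<phi> has_real_derivative g t) (at t) \<and> \<phi> t \<le> \<phi> 0"
    unfolding eventually_nhds_metric by blast
  have "g 0 = 0"
    using e by (intro DERIV_local_max[of \<phi> "g 0" 0 e]) (auto simp: dist_real_def)
  obtain e' where e': "e' > 0" "\<And>h. 0 < h \<Longrightarrow> h < e' \<Longrightarrow> g 0 < g (0 + h)"
    using DERIV_pos_inc_right[OF g(2) \<open>d > 0\<close>] by blast
  define s where "s = min e e' / 2"
  have s: "0 < s" "s < e" "s < e'"
    using e(1) e'(1) by (auto simp: s_def min_def)
  have "\<exists>x. 0 < x \<and> x < s \<and> \<phi> s - \<phi> 0 = (s - 0) * g x"
    using s by (intro MVT2) (auto simp: e dist_real_def)
  then obtain x where x: "0 < x" "x < s" "\<phi> s - \<phi> 0 = s * g x"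
    by auto
  have "g x > 0"
    using e'(2)[of x] x s \<open>g 0 = 0\<close> by simp
  with x s have "\<phi> s > \<phi> 0"
    by (metis diff_gt_0_iff_gt mult_pos_pos)
  moreover have "\<phi> s \<le> \<phi> 0"
    using e(2)[of s] s by (simp add: dist_real_def)
  ultimately show False by simp
qed

lemma has_laplacian_local_max:
  assumes "has_laplacian f z L" "\<forall>\<^sub>F w in nhds z. f w \<le> f z"
  shows "L \<le> 0"
proof -
  obtain d1 d2 where d: "has_dir_deriv2 1 f z d1" "has_dir_deriv2 \<i> f z d2" "L = d1 + d2"
    using assms(1) by (rule has_laplacianE)
  show ?thesis
    using d(1,2)[THEN has_dir_deriv2_local_max, OF assms(2)] d(3) by simp
qed

section \<open>Laplacians of logarithms and of radial functions\<close>

lemma has_derivative_imp_line_derivative: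
  fixes h :: "complex \<Rightarrow> real"
  assumes "(h has_derivative h') (at (z + of_real t * b))"
  shows "((\<lambda>t. h (z + of_real t * b)) has_real_derivative h' b) (at t)"
proof -
  have "((\<lambda>t. z + of_real t * b) has_derivative (\<lambda>s. of_real s * b)) (at t)"
    by (auto intro!: derivative_eq_intros)
  from has_derivative_compose[OF this assms]
  have "((\<lambda>t. h (z + of_real t * b)) has_derivative (\<lambda>s. h' (of_real s * b))) (at t)" .
  moreover have "h' (of_real s * b) = h' b * s" for s
    using linear_scale[OF has_derivative_linear[OF assms], of s b]
    by (simp add: scaleR_conv_of_real)
  ultimately show ?thesis
    by (simp add: has_field_derivative_def)
qed

text \<open>This links the Frechet-based \<open>dir_deriv\<close> of the definitions with the
  line-based notion. The formula \<open>dir_deriv b f w / f w\<close> for the first derivative holds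
  on all of the open set \<open>S\<close>, so it may be differentiated once more at
  \<open>z\<close>.\<close>

lemma has_dir_deriv2_ln:
  assumes "open S" "C2_on S f" "\<And>w. w \<in> S \<Longrightarrow> 0 < f w" "z \<in> S" "b \<in> Basis"
  shows "has_dir_deriv2 b (\<lambda>w. ln (f w)) z (dir_deriv b (dir_deriv b (\<lambda>w. ln (f w))) z)"
proof -
  let ?F = "\<lambda>w. ln (f w)"
  have f: "f differentiable (at w)" "dir_deriv b f differentiable (at w)" if "w \<in> S" for w
    using assms that unfolding C2_on_def
    by (auto simp: differentiable_on_eq_differentiable_at)
  have F: "(?F has_derivative (\<lambda>v. frechet_derivative f (at w) v / f w)) (at w)" if "w \<in> S" for w
  proof -
    have "(f has_derivative frechet_derivative f (at w)) (at w)"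
      using f(1)[OF that] by (simp add: frechet_derivative_works)
    then show ?thesis
      using assms(3)[OF that] by (auto intro!: derivative_eq_intros simp: field_simps)
  qed
  have dF: "dir_deriv b ?F w = dir_deriv b f w / f w" if "w \<in> S" for w
    unfolding dir_deriv_def using frechet_derivative_at[OF F[OF that]] by metis
  have "(\<lambda>w. dir_deriv b f w / f w) differentiable (at z)"
    using f[OF \<open>z \<in> S\<close>] assms(3)[OF \<open>z \<in> S\<close>] by (intro differentiable_divide) auto
  then obtain D where "((\<lambda>w. dir_deriv b f w / f w) has_derivative D) (at z)"
    unfolding differentiable_def by blast
  from has_derivative_transform_within_open[OF this assms(1,4)]
  have D: "(dir_deriv b ?F has_derivative D) (at z)"
    by (simp only: dF)
  have "D = frechet_derivative (dir_deriv b ?F) (at z)"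
    using frechet_derivative_at[OF D] .
  then have D': "D b = dir_deriv b (dir_deriv b ?F) z"
    by (simp add: dir_deriv_def)
  have "((\<lambda>t. dir_deriv b ?F (z + of_real t * b)) has_real_derivative D b) (at 0)"
    using D by (intro has_derivative_imp_line_derivative) simp
  then have "((\<lambda>t. dir_deriv b ?F (z + of_real t * b)) has_real_derivative
      dir_deriv b (dir_deriv b ?F) z) (at 0)"
    by (simp only: D')
  moreover have "\<forall>\<^sub>F t in nhds 0.
      ((\<lambda>t. ?F (z + of_real t * b)) has_real_derivative dir_deriv b ?F (z + of_real t * b)) (at t)"
  proof -
    have "((\<lambda>t. z + of_real t * b) \<longlongrightarrow> z + of_real 0 * b) (nhds (0::real))"
      by (intro tendsto_intros filterlim_ident)
    then have "\<forall>\<^sub>F t in nhds (0::real). z + of_real t * b \<in> S"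
      using assms(1,4) by (intro topological_tendstoD) auto
    then show ?thesis
    proof eventually_elim
      case (elim t)
      from has_derivative_imp_line_derivative[OF F[OF elim]] dF[OF elim]
      show ?case by (simp add: dir_deriv_def)
    qed
  qed
  ultimately show ?thesis
    by (intro has_dir_deriv2I)
qed

lemma open_positive_set:
  assumes "open G" "continuous_on G (f :: complex \<Rightarrow> real)"
  shows "open {z \<in> G. 0 < f z}"
proof -
  have "open (G \<inter> f -` {0<..})"
    using assms by (intro continuous_open_preimage) auto
  moreover have "G \<inter> f -` {0<..} = {z \<in> G. 0 < f z}" by auto
  ultimately show ?thesis by simp
qed

text \<open>This is the definition of curvature cleared of its denominator, which is nonzero as
  \<open>l z\<close> is positive.\<close>

lemma has_laplacian_ln_pseudometric:
  assumes "conformal_pseudometric G l" "z \<in> G" "0 < l z"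
  shows "has_laplacian (\<lambda>w. ln (l w)) z (- curvature l z * (l z)\<^sup>2)"
proof -
  have S: "open {z \<in> G. 0 < l z}" "C2_on {z \<in> G. 0 < l z} l"
    using assms(1) by (auto simp: conformal_pseudometric_def intro: open_positive_set)
  have "has_dir_deriv2 b (\<lambda>w. ln (l w)) z (dir_deriv b (dir_deriv b (\<lambda>w. ln (l w))) z)"
    if "b \<in> Basis" for b
    by (rule has_dir_deriv2_ln[OF S]) (use assms that in auto)
  moreover have "(1::complex) \<in> Basis" "\<i> \<in> Basis" by (auto simp: Basis_complex_def)
  moreover have "- curvature l z * (l z)\<^sup>2 =
      dir_deriv 1 (dir_deriv 1 (\<lambda>w. ln (l w))) z + dir_deriv \<i> (dir_deriv \<i> (\<lambda>w. ln (l w))) z"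
    using assms(3) by (simp add: curvature_def laplacian_def Basis_complex_def)
  ultimately show ?thesis
    by (intro has_laplacianI)
qed

text \<open>Along a line with unit direction \<open>b\<close> the squared distance to
  \<open>y\<close> is a quadratic polynomial \<open>n\<close> in \<open>t\<close>, so the chain rule
  applies. The squares of the components of \<open>z - y\<close> along 1 and \<open>\<i>\<close> add
  up to the squared modulus. Using the squared modulus avoids the singularity of the norm at
  \<open>y\<close>.\<close>

lemma has_laplacian_radial:
  fixes F F' :: "real \<Rightarrow> real"
  assumes F: "\<forall>\<^sub>F \<rho> in nhds ((cmod (z - y))\<^sup>2). (F has_real_derivative F' \<rho>) (at \<rho>)"
    and F'_deriv: "(F' has_real_derivative F'') (at ((cmod (z - y))\<^sup>2))"
  shows "has_laplacian (\<lambda>w. F ((cmod (w - y))\<^sup>2)) z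
           (4 * (cmod (z - y))\<^sup>2 * F'' + 4 * F' ((cmod (z - y))\<^sup>2))"
proof -
  let ?N = "(cmod (z - y))\<^sup>2"
  have *: "has_dir_deriv2 b (\<lambda>w. F ((cmod (w - y))\<^sup>2)) z (4 * ((z - y) \<bullet> b)\<^sup>2 * F'' + 2 * F' ?N)"
    if "norm b = 1" for b
  proof -
    define \<beta> where "\<beta> = (z - y) \<bullet> b"
    define n where "n t = ?N + 2 * \<beta> * t + t\<^sup>2" for t :: real
    have n: "(cmod (z + of_real t * b - y))\<^sup>2 = n t" for t :: real
    proof -
      have *: "z + of_real t * b - y = (z - y) + t *\<^sub>R b"
        by (simp add: scaleR_conv_of_real)
      have "(cmod (z + of_real t * b - y))\<^sup>2 = ?N + (norm (t *\<^sub>R b))\<^sup>2 + 2 * ((z - y) \<bullet> (t *\<^sub>R b))"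
        unfolding * using dot_norm[of "z - y" "t *\<^sub>R b"] by argo
      also have "\<dots> = n t"
        using that by (simp add: n_def \<beta>_def del: inner_complex_def)
      finally show ?thesis .
    qed
    have dn: "(n has_real_derivative 2 * \<beta> + 2 * t) (at t)" for t
      unfolding n_def by (auto intro!: derivative_eq_intros)
    have n0: "n 0 = ?N" by (simp add: n_def)
    have "(n \<longlongrightarrow> n 0) (nhds 0)"
      unfolding n_def by (intro tendsto_intros filterlim_ident)
    then have "\<forall>\<^sub>F t in nhds 0. (F has_real_derivative F' (n t)) (at (n t))"
      using F n0 by (intro eventually_compose_filterlim[OF F]) simp
    then have "\<forall>\<^sub>F t in nhds 0.
        ((\<lambda>t. F (n t)) has_real_derivative F' (n t) * (2 * \<beta> + 2 * t)) (at t)"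
      by eventually_elim (rule DERIV_chain2[OF _ dn])
    moreover have "((\<lambda>t. F' (n t) * (2 * \<beta> + 2 * t)) has_real_derivative
        4 * \<beta>\<^sup>2 * F'' + 2 * F' ?N) (at 0)"
    proof -
      have "((\<lambda>t. F' (n t)) has_real_derivative F'' * (2 * \<beta> + 2 * 0)) (at 0)"
        using F'_deriv by (intro DERIV_chain2[OF _ dn]) (simp add: n0)
      then show ?thesis
        by (auto intro!: derivative_eq_intros simp: n0 power2_eq_square)
    qed
    ultimately show ?thesis
      unfolding \<beta>_def[symmetric] by (intro has_dir_deriv2I) (simp_all only: n)
  qed
  have "4 * ?N * F'' + 4 * F' ?N =
     (4 * ((z - y) \<bullet> 1)\<^sup>2 * F'' + 2 * F' ?N) + (4 * ((z - y) \<bullet> \<i>)\<^sup>2 * F'' + 2 * F' ?N)"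
    by (simp add: cmod_power2 algebra_simps)
  then show ?thesis
    using has_laplacianI[OF *[of 1] *[of \<i>]] by (metis norm_ii norm_one)
qed

section \<open>Comparison and the strong maximum principle\<close>

text \<open>The function \<open>m\<close> is a majorant for the Laplacian of \<open>ln mu\<close>
  that is defined also at the zeros of \<open>mu\<close>. It makes the inequality for
  \<open>ln q\<close> linear, so that explicit barriers can be compared with it.\<close>

locale dominated_pair =
  fixes G :: "complex set" and lam mu q m :: "complex \<Rightarrow> real"
  assumes lam: "conformal_pseudometric G lam"
    and mu: "conformal_pseudometric G mu"
    and curvature_le: "\<And>z. z \<in> G \<Longrightarrow> 0 < lam z \<Longrightarrow> 0 < mu z \<Longrightarrow> curvature lam z \<le> curvature mu z"
    and curvature_bound: "\<And>z. z \<in> G \<Longrightarrow> 0 < mu z \<Longrightarrow>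
          curvature mu z \<le> 0 \<and> - curvature mu z * (mu z)\<^sup>2 \<le> m z"
    and m_pos: "\<And>z. z \<in> G \<Longrightarrow> 0 < m z"
    and discrete_zeros: "discrete {z \<in> G. mu z = 0}"
    and q: "is_quotient_extension G lam mu q"
begin

section \<open>Zeros of \<open>mu\<close> and the extended quotient\<close>

lemma open_G: "open G" and connected_G: "connected G"
  and continuous_mu: "continuous_on G mu" and continuous_lam: "continuous_on G lam"
  and continuous_q: "continuous_on G q"
  using lam mu q by (auto simp: conformal_pseudometric_def is_quotient_extension_def)

lemma q_range: "z \<in> G \<Longrightarrow> 0 \<le> q z \<and> q z \<le> 1"
  using q by (auto simp: is_quotient_extension_def)

lemma q_eq: "z \<in> G \<Longrightarrow> mu z \<noteq> 0 \<Longrightarrow> q z = lam z / mu z"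
  using q by (auto simp: is_quotient_extension_def)

lemma mu_nonneg: "z \<in> G \<Longrightarrow> 0 \<le> mu z"
  using mu by (auto simp: conformal_pseudometric_def)

text \<open>Discreteness excludes accumulation only at the zeros themselves. Accumulation at other
  points of \<open>G\<close> is excluded by continuity, since \<open>mu\<close> is positive near a
  point where it does not vanish.\<close>

lemma not_islimpt_zeros:
  assumes "z \<in> G"
  shows "\<not> z islimpt {w \<in> G. mu w = 0}"
proof (cases "mu z = 0")
  case True
  with assms discrete_zeros have "z isolated_in {w \<in> G. mu w = 0}"
    by (auto dest: discreteD)
  then show ?thesis
    by (simp add: isolated_in_islimpt_iff)
next
  case False
  then have "0 < mu z"
    using mu_nonneg[OF assms] by simp
  then have "z \<in> {z \<in> G. 0 < mu z}"
    using assms by simp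
  moreover have "open {z \<in> G. 0 < mu z}"
    by (rule open_positive_set[OF open_G continuous_mu])
  ultimately have "\<forall>\<^sub>F w in at z. w \<in> {z \<in> G. 0 < mu z}"
    by (intro eventually_at_in_open')
  then have "\<forall>\<^sub>F w in at z. w \<notin> {w \<in> G. mu w = 0}"
    by eventually_elim auto
  then show ?thesis
    by (simp add: islimpt_iff_eventually)
qed

lemma finite_zeros:
  assumes "compact K" "K \<subseteq> G"
  shows "finite {z \<in> K. mu z = 0}"
proof -
  have "finite (K \<inter> {w \<in> G. mu w = 0})"
    using assms by (intro finite_not_islimpt_in_compact not_islimpt_zeros) auto
  also have "K \<inter> {w \<in> G. mu w = 0} = {z \<in> K. mu z = 0}"
    using assms by auto
  finally show ?thesis .
qed

lemma lam_eq_q_mult_mu: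
  assumes "z \<in> G"
  shows "lam z = q z * mu z"
proof (cases "mu z = 0")
  case True
  have "((\<lambda>w. lam w - q w * mu w) \<longlongrightarrow> lam z - q z * mu z) (at z)"
    using continuous_lam continuous_q continuous_mu assms
    by (intro tendsto_intros) (simp_all add: continuous_on_eq_continuous_at[OF open_G] isCont_def)
  moreover have "\<forall>\<^sub>F w in at z. lam w - q w * mu w = 0"
  proof -
    have "\<forall>\<^sub>F w in at z. w \<notin> {w \<in> G. mu w = 0}"
      using not_islimpt_zeros[OF assms] by (simp add: islimpt_iff_eventually)
    moreover have "\<forall>\<^sub>F w in at z. w \<in> G"
      using open_G assms by (intro eventually_at_in_open') auto
    ultimately show ?thesis
      by eventually_elim (simp add: q_eq)
  qed
  ultimately have "lam z - q z * mu z = 0"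
    using tendsto_unique[OF at_neq_bot _ tendsto_eventually] by blast
  then show ?thesis by simp
next
  case False
  then show ?thesis using assms by (simp add: q_eq)
qed

text \<open>With \<open>k = curvature mu z\<close>, the Laplacian is at least
  \<open>k * mu^2 * (1 - q^2)\<close> by the curvature inequality, hence at least
  \<open>- m * (1 - q^2)\<close>, and \<open>1 - q^2 \<le> - 2 * ln q\<close>. The difference of
  logarithms equals \<open>ln q\<close> near \<open>z\<close> and has a Laplacian that is already
  known.\<close>

lemma laplacian_ln_quotient:
  assumes "z \<in> G" "0 < mu z" "0 < q z"
  shows "\<exists>L. has_laplacian (\<lambda>w. ln (lam w) - ln (mu w)) z L \<and> 2 * m z * ln (q z) \<le> L"
proof -
  have lz: "lam z = q z * mu z" "0 < lam z"
    using lam_eq_q_mult_mu assms by auto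
  let ?k = "curvature mu z"
  let ?L = "- curvature lam z * (lam z)\<^sup>2 - - ?k * (mu z)\<^sup>2"
  have "has_laplacian (\<lambda>w. ln (lam w) - ln (mu w)) z ?L"
    using assms lz by (intro has_laplacian_diff has_laplacian_ln_pseudometric[OF lam]
        has_laplacian_ln_pseudometric[OF mu])
  moreover have "2 * m z * ln (q z) \<le> ?L"
  proof -
    have k: "?k \<le> 0" "- ?k * (mu z)\<^sup>2 \<le> m z"
      using curvature_bound assms by auto
    have q1: "0 \<le> 1 - (q z)\<^sup>2"
      using q_range[OF assms(1)] by (simp add: power_le_one)
    have "1 - (q z)\<^sup>2 \<le> - (2 * ln (q z))"
      using ln_le_minus_one[of "(q z)\<^sup>2"] assms by (simp add: ln_realpow)
    moreover have "0 \<le> m z"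
      using m_pos[OF assms(1)] by simp
    ultimately have "m z * (1 - (q z)\<^sup>2) \<le> m z * - (2 * ln (q z))"
      by (intro mult_left_mono)
    moreover have "- ?k * (mu z)\<^sup>2 * (1 - (q z)\<^sup>2) \<le> m z * (1 - (q z)\<^sup>2)"
      using k q1 by (intro mult_right_mono)
    moreover have "- ?k * (lam z)\<^sup>2 \<le> - curvature lam z * (lam z)\<^sup>2"
      using curvature_le[OF assms(1) lz(2) assms(2)] by (intro mult_right_mono) auto
    moreover have "- ?k * (lam z)\<^sup>2 = - ?k * (mu z)\<^sup>2 * (q z)\<^sup>2"
      by (simp add: lz(1) power_mult_distrib)
    ultimately show ?thesis
      unfolding right_diff_distrib by linarith
  qed
  ultimately show ?thesis by blast
qed

end

text \<open>The function is radial with profile \<open>ln (\<rho> / d^2) / 2\<close> in the squared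
  distance to \<open>j\<close>, and the two terms of the radial formula cancel.\<close>

lemma has_laplacian_ln_cmod_diff:
  assumes "z \<noteq> j" "0 < d"
  shows "has_laplacian (\<lambda>w. ln (cmod (w - j) / d)) z 0"
proof -
  let ?N = "(cmod (z - j))\<^sup>2"
  have N: "?N > 0" using assms by simp
  have "\<forall>\<^sub>F \<rho> in nhds ?N. ((\<lambda>\<rho>. ln (\<rho> / d\<^sup>2) / 2) has_real_derivative 1 / (2 * \<rho>)) (at \<rho>)"
  proof -
    have "\<forall>\<^sub>F \<rho> in nhds ?N. \<rho> \<in> {0<..}"
      using N by (intro eventually_nhds_in_open) auto
    then show ?thesis
      by (rule eventually_mono) (use assms(2) in \<open>auto intro!: derivative_eq_intros\<close>)
  qed
  moreover have "((\<lambda>\<rho>. 1 / (2 * \<rho>)) has_real_derivative - 1 / (2 * ?N\<^sup>2)) (at ?N)"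
    using N by (auto intro!: derivative_eq_intros simp: power2_eq_square)
  ultimately have "has_laplacian (\<lambda>w. ln ((cmod (w - j))\<^sup>2 / d\<^sup>2) / 2) z
      (4 * ?N * (- 1 / (2 * ?N\<^sup>2)) + 4 * (1 / (2 * ?N)))"
    by (rule has_laplacian_radial)
  moreover have "4 * ?N * (- 1 / (2 * ?N\<^sup>2)) + 4 * (1 / (2 * ?N)) = 0"
    using N by (simp add: power2_eq_square)
  moreover have "ln ((cmod (w - j))\<^sup>2 / d\<^sup>2) / 2 = ln (cmod (w - j) / d)" for w
  proof (cases "w = j")
    case False
    have "(cmod (w - j))\<^sup>2 / d\<^sup>2 = (cmod (w - j) / d)\<^sup>2"
      by (simp add: power_divide)
    also have "ln \<dots> = 2 * ln (cmod (w - j) / d)"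
      using False assms(2) by (simp add: ln_realpow)
    finally show ?thesis by simp
  qed simp
  ultimately show ?thesis by simp
qed

context dominated_pair
begin

text \<open>
  \<open>ln q\<close> need not be smooth at the zeros \<open>j\<close> of \<open>mu\<close> in \<open>K\<close>. The proof multiplies \<open>q * exp v\<close> by a small
  power of \<open>\<Prod>j. cmod (z - j) / d\<close>: the logarithm of this factor is harmonic, and the factor keeps
  the maximum away from the zeros.
\<close>

lemma comparison:
  assumes K: "compact K" "K \<subseteq> G" and A: "open A" "A \<subseteq> K"
    and v: "continuous_on K v"
    and sub: "\<And>z. z \<in> A \<Longrightarrow> 0 < v z \<Longrightarrow> \<exists>L. has_laplacian v z L \<and> 2 * m z * v z \<le> L"
    and bdry: "\<And>z. z \<in> K \<Longrightarrow> z \<notin> A \<Longrightarrow> q z * exp (v z) \<le> 1"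
    and "z \<in> K"
  shows "q z * exp (v z) \<le> 1"
proof (rule ccontr)
  assume neg: "\<not> q z * exp (v z) \<le> 1"
  define Q where "Q w = q w * exp (v w)" for w
  have cont_Q: "continuous_on K Q"
    unfolding Q_def using v by (intro continuous_intros continuous_on_subset[OF continuous_q K(2)])
  define Z where "Z = {w \<in> K. mu w = 0}"
  have fin: "finite Z"
    unfolding Z_def by (rule finite_zeros[OF K])
  \<comment> \<open>Dividing by \<open>d\<close> makes every factor of \<open>P\<close> at most 1 on
    \<open>K\<close>; the summand 1 keeps \<open>d\<close> positive even when \<open>K\<close> is a
    single point.\<close>
  define d where "d = diameter K + 1"
  have d: "0 < d" "cmod (x - y) / d \<le> 1" if "x \<in> K" "y \<in> K" for x y
    using diameter_bounded_bound[OF compact_imp_bounded[OF K(1)] that]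
      diameter_ge_0[OF compact_imp_bounded[OF K(1)]] by (auto simp: d_def dist_norm)
  have d0: "0 < d"
    using d(1)[OF \<open>z \<in> K\<close> \<open>z \<in> K\<close>] .
  define P where "P w = (\<Prod>j\<in>Z. cmod (w - j) / d)" for w
  have P: "0 \<le> P w" "P w \<le> 1" if "w \<in> K" for w
    using d that d0 unfolding P_def Z_def by (auto intro!: prod_nonneg prod_le_1)
  have P_pos: "0 < P w" if "w \<notin> Z" for w
    unfolding P_def
  proof (intro prod_pos ballI divide_pos_pos d0)
    fix j assume "j \<in> Z"
    with that show "0 < cmod (w - j)" by auto
  qed
  have cont_P: "continuous_on K P"
    unfolding P_def using d0 by (intro continuous_intros) auto
  have "z \<in> A" "1 < Q z"
    using neg bdry[OF \<open>z \<in> K\<close>] by (auto simp: Q_def)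
  \<comment> \<open>The point \<open>z\<close> may itself be a zero of \<open>mu\<close>. Since
    \<open>Q > 1\<close> is an open condition and \<open>Z\<close> is finite, a nearby point outside
    \<open>Z\<close> serves instead.\<close>
  obtain z1 where z1: "z1 \<in> A" "1 < Q z1" "z1 \<notin> Z"
  proof -
    have "continuous_on A Q"
      by (rule continuous_on_subset[OF cont_Q A(2)])
    then have "(Q \<longlongrightarrow> Q z) (at z)"
      using \<open>z \<in> A\<close> by (simp add: continuous_on_eq_continuous_at[OF A(1)] isCont_def)
    then have "\<forall>\<^sub>F w in at z. 1 < Q w"
      using \<open>1 < Q z\<close> by (rule order_tendstoD)
    moreover have "\<forall>\<^sub>F w in at z. w \<in> A"
      using A(1) \<open>z \<in> A\<close> by (rule eventually_at_in_open')
    moreover have "\<forall>\<^sub>F w in at z. w \<notin> Z"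
      using islimpt_finite[OF fin] by (simp add: islimpt_iff_eventually)
    ultimately have "\<forall>\<^sub>F w in at z. w \<in> A \<and> 1 < Q w \<and> w \<notin> Z"
      by eventually_elim simp
    then show ?thesis
      using eventually_happens'[OF at_neq_bot] that by blast
  qed
  \<comment> \<open>The exponent is small enough that the factor \<open>P powr \<delta>\<close>
    costs less than \<open>ln (Q z1)\<close>, so \<open>R z1\<close> stays above 1. The 1 in the
    denominator avoids division by zero when \<open>P z1 = 1\<close>.\<close>
  define \<delta> where "\<delta> = ln (Q z1) / (2 * (1 - ln (P z1)))"
  have lnP: "ln (P z1) \<le> 0"
    using P[of z1] P_pos[of z1] z1 A by auto
  have lnQ: "0 < ln (Q z1)"
    using z1 by simp
  have \<delta>: "0 < \<delta>" "0 < ln (Q z1) + \<delta> * ln (P z1)"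
  proof -
    show *: "0 < \<delta>"
      unfolding \<delta>_def using lnP lnQ by simp
    have "\<delta> * (1 - ln (P z1)) = ln (Q z1) / 2"
      unfolding \<delta>_def using lnP by (simp add: field_simps)
    with * lnQ show "0 < ln (Q z1) + \<delta> * ln (P z1)"
      by (simp add: right_diff_distrib)
  qed
  define R where "R w = Q w * P w powr \<delta>" for w
  have cont_R: "continuous_on K R"
    unfolding R_def using P(1) \<delta>(1)
    by (intro continuous_on_mult cont_Q continuous_on_powr' cont_P continuous_intros) auto
  obtain p where p: "p \<in> K" "\<And>w. w \<in> K \<Longrightarrow> R w \<le> R p"
    using continuous_attains_sup[OF K(1) _ cont_R] \<open>z \<in> K\<close> by blast
  have "1 < R z1"
  proof -
    have "R z1 = exp (ln (Q z1) + \<delta> * ln (P z1))"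
      unfolding R_def exp_add using z1(2) P_pos[OF z1(3)] by (simp add: powr_def)
    with \<delta>(2) show ?thesis by simp
  qed
  then have Rp: "1 < R p"
    using p(2)[of z1] z1 A by auto
  have Q0: "0 \<le> Q p"
    unfolding Q_def using q_range p K by auto
  have "P p powr \<delta> \<le> 1 powr \<delta>"
    using P[OF p(1)] \<delta>(1) by (intro powr_mono2) auto
  then have "R p \<le> Q p"
    unfolding R_def using Q0 by (simp add: mult_left_le)
  then have Qp: "1 < Q p"
    using Rp by simp
  \<comment> \<open>The maximum point of \<open>R\<close> is interior because
    \<open>Q \<le> 1\<close> on \<open>K - A\<close>, and it is not a zero of \<open>mu\<close>
    because \<open>P\<close>, hence \<open>R\<close>, vanishes on \<open>Z\<close>.\<close>
  have pA: "p \<in> A"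
    using bdry[OF p(1)] Qp by (auto simp: Q_def)
  have pZ: "p \<notin> Z"
  proof
    assume "p \<in> Z"
    then have "P p = 0"
      unfolding P_def using fin by auto
    with Rp show False by (simp add: R_def)
  qed
  have pG: "p \<in> G" and mu_p: "0 < mu p"
    using p K pZ mu_nonneg[of p] by (auto simp: Z_def)
  have qp: "0 < q p"
    using Qp q_range[OF pG] by (cases "q p = 0") (auto simp: Q_def)
  define U where "U = {w \<in> G. 0 < mu w} \<inter> {w \<in> G. 0 < q w} \<inter> A"
  have U: "open U" "p \<in> U"
    unfolding U_def using open_positive_set[OF open_G continuous_mu]
      open_positive_set[OF open_G continuous_q] A pG mu_p qp pA by auto
  \<comment> \<open>Near \<open>p\<close> this is \<open>ln R\<close>, split into summands whose
    Laplacians are known or bounded below.\<close>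
  define g where "g w = (ln (lam w) - ln (mu w)) + (v w + \<delta> * (\<Sum>j\<in>Z. ln (cmod (w - j) / d)))" for w
  have g: "g w = ln (R w)" "0 < R w" if "w \<in> U" for w
  proof -
    from that have w: "w \<in> G" "0 < mu w" "0 < q w" "w \<in> A" "w \<notin> Z"
      by (auto simp: U_def Z_def)
    have "ln (lam w) = ln (q w) + ln (mu w)"
      using w lam_eq_q_mult_mu by (simp add: ln_mult)
    moreover have "ln (P w) = (\<Sum>j\<in>Z. ln (cmod (w - j) / d))"
      unfolding P_def using w d0 fin by (intro ln_prod) auto
    moreover have "ln (R w) = ln (q w) + v w + \<delta> * ln (P w)"
      unfolding R_def Q_def using w P_pos[OF w(5)] by (simp add: ln_mult ln_powr)
    ultimately show "g w = ln (R w)"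
      by (simp add: g_def)
    show "0 < R w"
      unfolding R_def Q_def using w P_pos[OF w(5)] by simp
  qed
  have "\<forall>\<^sub>F w in nhds p. w \<in> U"
    using U by (rule eventually_nhds_in_open)
  then have "\<forall>\<^sub>F w in nhds p. g w \<le> g p"
  proof eventually_elim
    case (elim w)
    then have "w \<in> K"
      using A by (auto simp: U_def)
    with p(2) show ?case
      using g elim U by simp
  qed
  moreover obtain L where L: "has_laplacian (\<lambda>w. ln (lam w) - ln (mu w)) p L" "2 * m p * ln (q p) \<le> L"
    using laplacian_ln_quotient[OF pG mu_p qp] by blast
  \<comment> \<open>From \<open>Q p > 1\<close> and \<open>q p \<le> 1\<close> it follows that
    \<open>v p > 0\<close>, so \<open>sub\<close> applies at \<open>p\<close>. The Laplacian of
    \<open>g\<close> is then at least \<open>2 * m p * (ln (q p) + v p) > 0\<close>, contrary to the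
    maximum.\<close>
  moreover have v_pos: "0 < ln (q p) + v p" "0 < v p"
  proof -
    have "ln (Q p) = ln (q p) + v p"
      using qp by (simp add: Q_def ln_mult)
    with Qp show "0 < ln (q p) + v p"
      by (metis ln_gt_zero)
    moreover have "ln (q p) \<le> 0"
      using qp q_range[OF pG] by simp
    ultimately show "0 < v p" by simp
  qed
  moreover obtain L' where L': "has_laplacian v p L'" "2 * m p * v p \<le> L'"
    using sub[OF pA] v_pos by blast
  moreover have "has_laplacian (\<lambda>w. \<Sum>j\<in>Z. ln (cmod (w - j) / d)) p (\<Sum>j\<in>Z. 0)"
    using fin pZ d0 by (intro has_laplacian_sum has_laplacian_ln_cmod_diff) auto
  then have "has_laplacian g p (L + (L' + \<delta> * (\<Sum>j\<in>Z. 0)))"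
    unfolding g_def by (intro has_laplacian_add has_laplacian_cmult L L')
  ultimately have "L + L' \<le> 0"
    using has_laplacian_local_max by fastforce
  moreover have "0 < 2 * m p * (ln (q p) + v p)"
    using m_pos[OF pG] v_pos by simp
  ultimately show False
    using L(2) L'(2) by (simp add: distrib_left)
qed

text \<open>Near \<open>y\<close> the quotient stays below some \<open>\<theta> < 1\<close>. On the
  surrounding annulus the Hopf barrier \<open>v\<close> vanishes on the outer circle, is at most
  \<open>- ln \<theta>\<close> on the inner one and is positive in between. The comparison gives
  \<open>q w \<le> exp (- v w) < 1\<close>.\<close>

lemma quotient_less_one_ball:
  assumes m: "continuous_on G m" and y: "y \<in> G" "q y < 1" and r: "cball y r \<subseteq> G" and w: "w \<in> ball y r"
  shows "q w < 1"
proof -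
  have "0 < r"
    using w by (simp add: dist_norm) (metis norm_ge_zero order_le_less_trans)
  have "compact (m ` cball y r)"
    by (intro compact_continuous_image continuous_on_subset[OF m r] compact_cball)
  then have "bounded (m ` cball y r)"
    by (rule compact_imp_bounded)
  then obtain M where M: "0 < M" "\<forall>x\<in>m ` cball y r. norm x \<le> M"
    unfolding bounded_pos by blast
  have m_le: "m z \<le> M" if "z \<in> cball y r" for z
    using bspec[OF M(2) imageI[OF that]] by simp
  define \<theta> where "\<theta> = (1 + q y) / 2"
  have \<theta>: "0 < \<theta>" "\<theta> < 1" "q y < \<theta>"
    using q_range[OF y(1)] y(2) by (auto simp: \<theta>_def)
  have "(q \<longlongrightarrow> q y) (nhds y)"
    using continuous_q y(1) by (simp add: continuous_on_eq_continuous_at[OF open_G] isCont_def tendsto_at_iff_tendsto_nhds)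
  then have "\<forall>\<^sub>F x in nhds y. q x < \<theta>"
    using \<theta>(3) by (rule order_tendstoD)
  then obtain e where e: "0 < e" "\<And>x. dist x y < e \<Longrightarrow> q x < \<theta>"
    unfolding eventually_nhds_metric by blast
  define s where "s = min e r / 2"
  have s: "0 < s" "s < r" "\<And>x. dist y x \<le> s \<Longrightarrow> q x < \<theta>"
    using e \<open>0 < r\<close> by (auto simp: s_def dist_commute min_def split: if_splits)
  \<comment> \<open>Two properties are required: \<open>\<alpha> * s^2 \<ge> 2\<close> makes
    \<open>\<alpha> * N - 1\<close> at least 1 on the annulus, and \<open>\<alpha> \<ge> M\<close>
    then lets the Laplacian of the barrier dominate the term with \<open>m\<close>.\<close>
  define \<alpha> where "\<alpha> = 2 / s\<^sup>2 + M"
  have \<alpha>: "0 < \<alpha>" "M \<le> \<alpha>" "2 \<le> \<alpha> * s\<^sup>2"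
    using s M by (auto simp: \<alpha>_def field_simps intro: add_pos_pos)
  \<comment> \<open>With this height \<open>exp \<epsilon> = 1 / \<theta>\<close>, which compensates
    exactly for \<open>q \<le> \<theta>\<close> on the inner circle.\<close>
  define \<epsilon> where "\<epsilon> = - ln \<theta>"
  have \<epsilon>: "0 < \<epsilon>"
    using \<theta> by (simp add: \<epsilon>_def)
  define v where "v x = \<epsilon> * (exp (- \<alpha> * (cmod (x - y))\<^sup>2) - exp (- \<alpha> * r\<^sup>2))" for x
  show ?thesis
  proof (cases "dist y w \<le> s")
    case True
    then show ?thesis using s(3) \<theta> by fastforce
  next
    case False
    have "q w * exp (v w) \<le> 1"
    proof (rule comparison[of "cball y r - ball y s" "ball y r - cball y s"])
      show "compact (cball y r - ball y s)"
        by (intro compact_diff) auto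
      show "cball y r - ball y s \<subseteq> G" using r by auto
      show "open (ball y r - cball y s)" by auto
      show "ball y r - cball y s \<subseteq> cball y r - ball y s" by auto
      show "continuous_on (cball y r - ball y s) v"
        unfolding v_def by (intro continuous_intros)
      show "w \<in> cball y r - ball y s"
        using w False by auto
    next
      fix x assume x: "x \<in> cball y r - ball y s" "x \<notin> ball y r - cball y s"
      have xG: "x \<in> G" using x r by auto
      from x consider "cmod (x - y) = r" | "cmod (x - y) = s"
        by (auto simp: dist_norm norm_minus_commute)
      then show "q x * exp (v x) \<le> 1"
      proof cases
        case 1
        with q_range[OF xG] show ?thesis by (simp add: v_def)
      next
        case 2
        have "v x \<le> \<epsilon> * 1"
          unfolding v_def
        proof (intro mult_left_mono)
          have "exp (- \<alpha> * (cmod (x - y))\<^sup>2) \<le> 1"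
            using \<alpha>(1) by simp
          then show "exp (- \<alpha> * (cmod (x - y))\<^sup>2) - exp (- \<alpha> * r\<^sup>2) \<le> 1"
            using exp_ge_zero[of "- \<alpha> * r\<^sup>2"] by linarith
        qed (use \<epsilon> in simp)
        then have "exp (v x) \<le> exp \<epsilon>"
          by simp
        also have "exp \<epsilon> = 1 / \<theta>"
          using \<theta> by (simp add: \<epsilon>_def exp_minus inverse_eq_divide)
        finally have "exp (v x) \<le> 1 / \<theta>" .
        moreover have "q x \<le> \<theta>" "0 \<le> q x"
          using s(3)[of x] 2 q_range[OF xG] by (auto simp: dist_norm norm_minus_commute)
        ultimately have "q x * exp (v x) \<le> \<theta> * (1 / \<theta>)"
          using \<theta> by (intro mult_mono) auto
        with \<theta> show ?thesis by simp
      qed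
    next
      fix x assume x: "x \<in> ball y r - cball y s" "0 < v x"
      define N where "N = (cmod (x - y))\<^sup>2"
      let ?e = "exp (- \<alpha> * N)"
      have "has_laplacian (\<lambda>w. \<epsilon> * (exp (- \<alpha> * (cmod (w - y))\<^sup>2) - exp (- \<alpha> * r\<^sup>2))) x
          (4 * (cmod (x - y))\<^sup>2 * (\<epsilon> * \<alpha>\<^sup>2 * ?e) + 4 * (- \<epsilon> * \<alpha> * exp (- \<alpha> * (cmod (x - y))\<^sup>2)))"
        by (rule has_laplacian_radial)
          (auto intro!: derivative_eq_intros always_eventually simp: power2_eq_square N_def)
      then have "has_laplacian v x (4 * \<epsilon> * ?e * (\<alpha> * (\<alpha> * N - 1)))"
        unfolding v_def N_def[symmetric] by (simp add: algebra_simps power2_eq_square)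
      moreover have "2 * m x * v x \<le> 4 * \<epsilon> * ?e * (\<alpha> * (\<alpha> * N - 1))"
      proof -
        have "m x \<le> M"
          using x by (intro m_le) auto
        then have "2 * m x * v x \<le> 2 * M * v x"
          using x(2) by (intro mult_right_mono) auto
        also have "\<dots> \<le> 2 * M * (\<epsilon> * ?e)"
          using M(1) \<epsilon> by (intro mult_left_mono) (auto simp: v_def N_def)
        also have "\<dots> = 2 * (\<epsilon> * ?e) * (M * 1)" by simp
        also have "\<dots> \<le> 2 * (\<epsilon> * ?e) * (\<alpha> * (\<alpha> * N - 1))"
        proof -
          have "s\<^sup>2 \<le> N"
            unfolding N_def using x s(1) by (intro power_mono) (auto simp: dist_norm norm_minus_commute)
          then have "\<alpha> * s\<^sup>2 \<le> \<alpha> * N"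
            using \<alpha>(1) by (intro mult_left_mono) auto
          then have "1 \<le> \<alpha> * N - 1"
            using \<alpha>(3) by linarith
          then show ?thesis
            using \<alpha> M \<epsilon> by (intro mult_left_mono mult_mono) auto
        qed
        also have "\<dots> \<le> 4 * \<epsilon> * ?e * (\<alpha> * (\<alpha> * N - 1))"
        proof -
          have "0 \<le> 2 * (\<epsilon> * ?e) * (M * 1)"
            using M \<epsilon> by simp
          with calculation have "0 \<le> 2 * (\<epsilon> * ?e) * (\<alpha> * (\<alpha> * N - 1))"
            using \<open>2 * (\<epsilon> * ?e) * (M * 1) \<le> 2 * (\<epsilon> * ?e) * (\<alpha> * (\<alpha> * N - 1))\<close> by linarith
          then show ?thesis by linarith
        qed
        finally show ?thesis .
      qed
      ultimately show "\<exists>L. has_laplacian v x L \<and> 2 * m x * v x \<le> L" by blast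
    qed
    moreover have "0 < v w"
    proof -
      have "(cmod (w - y))\<^sup>2 < r\<^sup>2"
        using w by (intro power_strict_mono) (auto simp: dist_norm norm_minus_commute)
      then show ?thesis
        using \<epsilon> \<alpha> by (simp add: v_def)
    qed
    then have "1 < exp (v w)" by simp
    ultimately have "q w \<noteq> 1" by auto
    then show ?thesis
      using q_range[of w] w r by (auto simp: order_less_le)
  qed
qed

text \<open>By connectedness it suffices that \<open>q = 1\<close> is an open condition in
  \<open>G\<close>. If \<open>q x = 1\<close> but \<open>q u < 1\<close> at a point within
  \<open>e / 2\<close> of \<open>x\<close>, the disk of radius \<open>e / 2\<close> about
  \<open>u\<close> still lies in \<open>G\<close> and contains \<open>x\<close>, so the local lemma
  centred at \<open>u\<close> gives a contradiction.\<close>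

lemma quotient_less_one:
  assumes "continuous_on G m" "y \<in> G" "q y < 1" "w \<in> G"
  shows "q w < 1"
proof (rule ccontr)
  assume "\<not> q w < 1"
  then have qw: "q w = 1"
    using q_range[OF \<open>w \<in> G\<close>] by simp
  define S where "S = {x \<in> G. 0 < 1 - q x}"
  define T where "T = {x \<in> G. q x = 1}"
  have "open S"
    unfolding S_def by (intro open_positive_set open_G continuous_intros continuous_q)
  moreover have "open T"
    unfolding open_contains_ball
  proof
    fix x assume "x \<in> T"
    then have x: "x \<in> G" "q x = 1" by (auto simp: T_def)
    obtain e where e: "0 < e" "cball x e \<subseteq> G"
      using open_G x(1) open_contains_cball by blast
    have "u \<in> T" if u: "u \<in> ball x (e / 2)" for u
    proof (rule ccontr)
      assume "u \<notin> T"
      have "cball u (e / 2) \<subseteq> cball x e"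
        using u by (simp add: cball_subset_cball_iff dist_commute)
      then have sub: "cball u (e / 2) \<subseteq> G"
        using e by blast
      then have "u \<in> G"
        using e by (auto dest: subsetD[of _ _ u])
      with \<open>u \<notin> T\<close> q_range[of u] have "q u < 1"
        by (auto simp: T_def)
      from quotient_less_one_ball[OF assms(1) \<open>u \<in> G\<close> this sub, of x] u x(2)
      show False by (simp add: dist_commute)
    qed
    with e(1) show "\<exists>e>0. ball x e \<subseteq> T"
      by (intro exI[of _ "e / 2"]) auto
  qed
  moreover have "S \<inter> T \<inter> G = {}" "G \<subseteq> S \<union> T"
    using q_range by (auto simp: S_def T_def order_less_le)
  moreover have "S \<inter> G \<noteq> {}" "T \<inter> G \<noteq> {}"
    using assms qw by (auto simp: S_def T_def)
  ultimately show False
    using connected_G unfolding connected_def by blast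
qed

end

section \<open>Ahlfors' lemma and the boundary barrier\<close>

text \<open>On a smaller disk \<open>l\<close> is compared with \<open>r / (r^2 - |w|^2)\<close>,
  the density of curvature -4 that blows up on the circle of radius \<open>r\<close>. The ratio
  therefore has an interior maximum wherever it is positive, where the Laplacian of its logarithm is
  at most 0. Letting \<open>r\<close> tend to 1 gives the bound.\<close>

lemma pseudometric_le_hyperbolic:
  assumes l: "conformal_pseudometric (ball 0 1) l"
    and curv: "\<And>w. w \<in> ball 0 1 \<Longrightarrow> 0 < l w \<Longrightarrow> curvature l w \<le> - 4"
    and z: "z \<in> ball 0 1"
  shows "l z \<le> 1 / (1 - (cmod z)\<^sup>2)"
proof -
  have cont: "continuous_on (ball 0 1) l" and nonneg: "\<And>w. w \<in> ball 0 1 \<Longrightarrow> 0 \<le> l w"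
    using l by (auto simp: conformal_pseudometric_def)
  have *: "l z * (r\<^sup>2 - (cmod z)\<^sup>2) \<le> r" if r: "cmod z < r" "r < 1" for r
  proof -
    have "0 < r" using r(1) norm_ge_zero[of z] by linarith
    have sub: "cball 0 r \<subseteq> ball (0 :: complex) 1" using r by auto
    define h where "h w = l w * (r\<^sup>2 - (cmod w)\<^sup>2)" for w
    have "continuous_on (cball 0 r) h"
      unfolding h_def by (intro continuous_intros continuous_on_subset[OF cont sub])
    then obtain p where p: "p \<in> cball 0 r" "\<And>w. w \<in> cball 0 r \<Longrightarrow> h w \<le> h p"
      using continuous_attains_sup[of "cball 0 r" h] \<open>0 < r\<close> by auto
    have "h p \<le> r"
    proof (cases "h p \<le> 0")
      case True
      with \<open>0 < r\<close> show ?thesis by simp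
    next
      case False
      have "cmod p \<noteq> r" using False by (auto simp: h_def)
      then have pr: "cmod p < r" using p(1) by simp
      then have pb: "p \<in> ball 0 1" using r by simp
      have lp: "0 < l p" using False nonneg[OF pb] by (cases "l p = 0") (auto simp: h_def)
      define U where "U = {w \<in> ball 0 1. 0 < l w} \<inter> ball 0 r"
      have U: "open U" "p \<in> U"
        unfolding U_def using open_positive_set[OF open_ball cont] pb lp pr by auto
      have pos: "0 < r\<^sup>2 - (cmod w)\<^sup>2" if "w \<in> U" for w
        using that by (auto simp: U_def intro!: power_strict_mono)
      \<comment> \<open>The term \<open>w - 0\<close> is kept to match
        \<open>has_laplacian_radial\<close> with centre 0.\<close>
      define g where "g w = ln (l w) + ln (r\<^sup>2 - (cmod (w - 0))\<^sup>2)" for w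
      have "\<forall>\<^sub>F w in nhds p. w \<in> U"
        using U by (rule eventually_nhds_in_open)
      then have "\<forall>\<^sub>F w in nhds p. g w \<le> g p"
      proof eventually_elim
        case (elim w)
        have g: "g w = ln (h w)" "0 < h w" if "w \<in> U" for w
          using that pos[OF that] by (auto simp: g_def h_def U_def ln_mult)
        have "h w \<le> h p"
          using elim by (intro p(2)) (auto simp: U_def)
        then show ?case
          using g[OF elim] g[OF U(2)] by simp
      qed
      moreover have "has_laplacian g p (- curvature l p * (l p)\<^sup>2 +
          (4 * (cmod (p - 0))\<^sup>2 * (- 1 / (r\<^sup>2 - (cmod (p - 0))\<^sup>2)\<^sup>2) + 4 * (- 1 / (r\<^sup>2 - (cmod (p - 0))\<^sup>2))))"
        unfolding g_def
      proof (intro has_laplacian_add has_laplacian_ln_pseudometric[OF l pb lp]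
          has_laplacian_radial[where F' = "\<lambda>\<rho>. - 1 / (r\<^sup>2 - \<rho>)"])
        have "\<forall>\<^sub>F \<rho> in nhds ((cmod (p - 0))\<^sup>2). \<rho> \<in> {..<r\<^sup>2}"
          using pos[OF U(2)] by (intro eventually_nhds_in_open) auto
        then show "\<forall>\<^sub>F \<rho> in nhds ((cmod (p - 0))\<^sup>2).
            ((\<lambda>\<rho>. ln (r\<^sup>2 - \<rho>)) has_real_derivative - 1 / (r\<^sup>2 - \<rho>)) (at \<rho>)"
          by (rule eventually_mono) (auto intro!: derivative_eq_intros)
        show "((\<lambda>\<rho>. - 1 / (r\<^sup>2 - \<rho>)) has_real_derivative - 1 / (r\<^sup>2 - (cmod (p - 0))\<^sup>2)\<^sup>2)
            (at ((cmod (p - 0))\<^sup>2))"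
          using pos[OF U(2)] by (auto intro!: derivative_eq_intros simp: power2_eq_square)
      qed
      ultimately have "- curvature l p * (l p)\<^sup>2 +
          (4 * (cmod (p - 0))\<^sup>2 * (- 1 / (r\<^sup>2 - (cmod (p - 0))\<^sup>2)\<^sup>2) + 4 * (- 1 / (r\<^sup>2 - (cmod (p - 0))\<^sup>2))) \<le> 0"
        by (intro has_laplacian_local_max)
      moreover have "4 * (l p)\<^sup>2 \<le> - curvature l p * (l p)\<^sup>2"
        using curv[OF pb lp] by (intro mult_right_mono) auto
      moreover define D where "D = r\<^sup>2 - (cmod p)\<^sup>2"
      have D: "0 < D" using pos[OF U(2)] by (simp add: D_def)
      ultimately have "(l p)\<^sup>2 \<le> (cmod p)\<^sup>2 / D\<^sup>2 + 1 / D"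
        unfolding diff_zero D_def[symmetric] by simp
      \<comment> \<open>The two terms from the radial formula combine to \<open>r^2 / D^2\<close>,
        since \<open>|p|^2 + D = r^2\<close>.\<close>
      moreover have "(cmod p)\<^sup>2 / D\<^sup>2 + 1 / D = ((cmod p)\<^sup>2 + D) / D\<^sup>2"
        using D by (simp add: add_divide_distrib power2_eq_square)
      moreover have "(cmod p)\<^sup>2 + D = r\<^sup>2"
        by (simp add: D_def)
      ultimately have "(l p)\<^sup>2 \<le> r\<^sup>2 / D\<^sup>2"
        by (simp only:)
      then have "(l p)\<^sup>2 * D\<^sup>2 \<le> r\<^sup>2"
        by (simp only: pos_le_divide_eq[OF zero_less_power[OF D]])
      then have "(l p * D)\<^sup>2 \<le> r\<^sup>2"
        by (simp only: power_mult_distrib)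
      then have "l p * D \<le> r"
        by (rule power2_le_imp_le) (use \<open>0 < r\<close> in simp)
      then show ?thesis by (simp add: h_def D_def)
    qed
    moreover have "h z \<le> h p" using r by (intro p(2)) auto
    ultimately show ?thesis by (simp add: h_def)
  qed
  have "cmod z < 1" using z by simp
  then have pos: "0 < 1 - (cmod z)\<^sup>2"
    by (simp add: power_less_one_iff)
  have "((\<lambda>r. r - l z * (r\<^sup>2 - (cmod z)\<^sup>2)) \<longlongrightarrow> 1 - l z * (1\<^sup>2 - (cmod z)\<^sup>2)) (at_left 1)"
    by (intro tendsto_intros)
  moreover have "\<forall>\<^sub>F r in at_left 1. 0 \<le> r - l z * (r\<^sup>2 - (cmod z)\<^sup>2)"
    using eventually_at_left_real[OF \<open>cmod z < 1\<close>] by (rule eventually_mono) (use * in auto)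
  ultimately have "0 \<le> 1 - l z * (1\<^sup>2 - (cmod z)\<^sup>2)"
    by (rule tendsto_lowerbound) simp
  then show ?thesis
    using pos by (simp add: field_simps)
qed

text \<open>
  \<open>\<Delta>v \<ge> 4 a v / s\<^sup>2\<close> for \<open>v = s\<^sup>a + 2 s\<^sup>a\<^sup>+\<^sup>1\<close>, \<open>s = 1 - |z|\<^sup>2\<close>, divided by 4. The power \<open>s\<^sup>a\<close> alone is not
  enough when \<open>a = 2\<close>; the second term supplies the missing order.
\<close>

lemma barrier_inequality:
  fixes a s :: real
  assumes "2 \<le> a" "0 < s" "s \<le> 2 / 9"
  shows "a * (s powr a + 2 * s powr (a + 1)) / s\<^sup>2 \<le>
    (1 - s) * (a * (a - 1) * s powr (a - 2) + 2 * (a + 1) * a * s powr (a - 1))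
      - (a * s powr (a - 1) + 2 * (a + 1) * s powr a)"
proof -
  \<comment> \<open>After the common factor \<open>t\<close> is removed, all powers of
    \<open>s\<close> become polynomial.\<close>
  define t where "t = s powr (a - 2)"
  have t: "0 < t" using assms by (simp add: t_def)
  have pw: "s powr (a - 2 + real n) = t * s ^ n" for n
    unfolding t_def using assms by (simp add: powr_add powr_realpow)
  have pws: "s powr (a - 1) = t * s" "s powr a = t * s ^ 2" "s powr (a + 1) = t * s ^ 3"
    using pw[of 1] pw[of 2] pw[of 3] by (simp_all add: add.commute)
  \<comment> \<open>As \<open>a \<ge> 2\<close> gives \<open>2 * (a + 1) \<le> 3 * a\<close>, the
    bound \<open>s \<le> 2 / 9\<close> is what makes
    \<open>2 * (a + 1)^2 * s \<le> a^2\<close>.\<close>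
  have "(2 * (a + 1))\<^sup>2 \<le> (3 * a)\<^sup>2"
    using assms by (intro power_mono) auto
  then have "4 * (a + 1)\<^sup>2 \<le> 9 * a\<^sup>2"
    by (simp only: power_mult_distrib) simp
  moreover have "(2 * (a + 1)\<^sup>2) * s \<le> (2 * (a + 1)\<^sup>2) * (2 / 9)"
    using assms by (intro mult_left_mono) auto
  ultimately have "0 \<le> a\<^sup>2 - 2 * (a + 1)\<^sup>2 * s"
    by linarith
  \<comment> \<open>This is the difference of the two sides of the claim. For \<open>a = 2\<close>
    the leading term vanishes and the second one, due to the correction in the barrier,
    decides.\<close>
  then have "0 \<le> t * (a * (a - 2) + s * (a\<^sup>2 - 2 * (a + 1)\<^sup>2 * s))"
    using assms t by simp
  also have "\<dots> = (1 - s) * (a * (a - 1) * t + 2 * (a + 1) * a * (t * s))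
      - (a * (t * s) + 2 * (a + 1) * (t * s ^ 2)) - a * (t + 2 * (t * s))"
    by (simp add: algebra_simps power2_eq_square power3_eq_cube)
  also have "a * (t + 2 * (t * s)) = a * (t * s ^ 2 + 2 * (t * s ^ 3)) / s\<^sup>2"
    using assms by (simp add: field_simps power2_eq_square power3_eq_cube)
  finally show ?thesis
    unfolding pws t_def[symmetric] by simp
qed

text \<open>The comparison needs a compact set, so it is applied on
  \<open>9 / 10 \<le> |z| \<le> R\<close> with \<open>R < 1\<close>, to the barrier shifted to
  vanish on the outer circle. The shift \<open>f (1 - R^2)\<close> tends to 0 as \<open>R\<close>
  tends to 1, while \<open>\<epsilon>\<close> does not depend on \<open>R\<close>.\<close>

lemma quotient_boundary_decay:
  assumes dom: "dominated_pair (ball 0 1) lam mu q (\<lambda>z. c / (1 - (cmod z)\<^sup>2)\<^sup>2)"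
    and c: "4 \<le> c" and less: "\<And>z. z \<in> ball 0 1 \<Longrightarrow> q z < 1"
  obtains \<epsilon> where "0 < \<epsilon>"
    "\<And>z. 9 / 10 \<le> cmod z \<Longrightarrow> cmod z < 1 \<Longrightarrow> q z \<le> exp (- \<epsilon> * (1 - (cmod z)\<^sup>2) powr (c / 2))"
proof -
  interpret dominated_pair "ball 0 1" lam mu q "\<lambda>z. c / (1 - (cmod z)\<^sup>2)\<^sup>2"
    by (rule dom)
  define a where "a = c / 2"
  have a: "2 \<le> a" "c = 2 * a" using c by (auto simp: a_def)
  define f where "f s = s powr a + 2 * s powr (a + 1)" for s :: real
  define f1 where "f1 s = a * s powr (a - 1) + 2 * (a + 1) * s powr a" for s :: real
  define f2 where "f2 s = a * (a - 1) * s powr (a - 2) + 2 * (a + 1) * a * s powr (a - 1)" for s :: real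
  have f: "(f has_real_derivative f1 s) (at s)" "(f1 has_real_derivative f2 s) (at s)" if "0 < s" for s
    unfolding f_def f1_def f2_def using that
    by (auto intro!: derivative_eq_intros simp: algebra_simps)
  have f0: "0 \<le> f s" for s
    by (simp add: f_def)
  have f_le: "f s \<le> 3" if "0 \<le> s" "s \<le> 1" for s
    using powr_mono2[of a s 1] powr_mono2[of "a + 1" s 1] that a by (simp add: f_def)
  have "sphere 0 (9 / 10) \<subseteq> ball (0 :: complex) 1" by auto
  then have "continuous_on (sphere 0 (9 / 10)) q"
    by (rule continuous_on_subset[OF continuous_q])
  moreover have "sphere (0 :: complex) (9 / 10) \<noteq> {}"
    by simp
  ultimately obtain p where p: "p \<in> sphere 0 (9 / 10)" "\<And>w. w \<in> sphere 0 (9 / 10) \<Longrightarrow> q w \<le> q p"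
    using continuous_attains_sup[of "sphere 0 (9 / 10)" q] by auto
  \<comment> \<open>The maximum with \<open>1 / 2\<close> keeps \<open>ln \<theta>\<close>
    meaningful when \<open>q\<close> vanishes on the circle.\<close>
  define \<theta> where "\<theta> = max (q p) (1 / 2)"
  have \<theta>: "0 < \<theta>" "\<theta> < 1" "\<And>w. cmod w = 9 / 10 \<Longrightarrow> q w \<le> \<theta>"
    using less[of p] p by (auto simp: \<theta>_def intro: max.coboundedI1)
  \<comment> \<open>The divisor 3 is the bound for \<open>f\<close> on the unit interval, so the
    barrier is at most \<open>- ln \<theta>\<close> on the inner circle.\<close>
  define \<epsilon> where "\<epsilon> = - ln \<theta> / 3"
  have \<epsilon>: "0 < \<epsilon>" using \<theta> by (simp add: \<epsilon>_def)
  have comp: "q z * exp (\<epsilon> * (f (1 - (cmod z)\<^sup>2) - f (1 - R\<^sup>2))) \<le> 1"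
    if z: "9 / 10 \<le> cmod z" "cmod z < R" and R: "R < 1" for z R
  proof (rule comparison[of "cball 0 R - ball 0 (9 / 10)" "ball 0 R - cball 0 (9 / 10)"
        "\<lambda>z. \<epsilon> * (f (1 - (cmod z)\<^sup>2) - f (1 - R\<^sup>2))"])
    show "compact (cball (0::complex) R - ball 0 (9 / 10))"
      by (intro compact_diff) auto
    show "cball (0::complex) R - ball 0 (9 / 10) \<subseteq> ball 0 1" using R by auto
    show "open (ball (0::complex) R - cball 0 (9 / 10))" by auto
    show "ball (0::complex) R - cball 0 (9 / 10) \<subseteq> cball 0 R - ball 0 (9 / 10)" by auto
    show "continuous_on (cball 0 R - ball 0 (9 / 10)) (\<lambda>z. \<epsilon> * (f (1 - (cmod z)\<^sup>2) - f (1 - R\<^sup>2)))"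
    proof -
      have "cmod z ^ 2 \<le> 1" if "z \<in> cball 0 R - ball 0 (9 / 10)" for z
        using that R by (intro power_le_one) auto
      then show ?thesis
        unfolding f_def using a by (intro continuous_intros continuous_on_powr') auto
    qed
    show "z \<in> cball 0 R - ball 0 (9 / 10)" using z by auto
  next
    fix x :: complex
    assume x: "x \<in> cball 0 R - ball 0 (9 / 10)" "x \<notin> ball 0 R - cball 0 (9 / 10)"
    have xG: "x \<in> ball 0 1" using x R by auto
    from x consider "cmod x = R" | "cmod x = 9 / 10" by auto
    then show "q x * exp (\<epsilon> * (f (1 - (cmod x)\<^sup>2) - f (1 - R\<^sup>2))) \<le> 1"
    proof cases
      case 1
      with q_range[OF xG] show ?thesis by simp
    next
      case 2
      have "f (1 - (cmod x)\<^sup>2) - f (1 - R\<^sup>2) \<le> 3"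
      proof -
        have "0 \<le> 1 - (cmod x)\<^sup>2" "1 - (cmod x)\<^sup>2 \<le> 1"
          unfolding 2 by (simp_all add: power2_eq_square)
        from f_le[OF this] f0[of "1 - R\<^sup>2"] show ?thesis by linarith
      qed
      then have "\<epsilon> * (f (1 - (cmod x)\<^sup>2) - f (1 - R\<^sup>2)) \<le> \<epsilon> * 3"
        using \<epsilon> by (intro mult_left_mono) auto
      then have "exp (\<epsilon> * (f (1 - (cmod x)\<^sup>2) - f (1 - R\<^sup>2))) \<le> exp (\<epsilon> * 3)"
        by simp
      also have "exp (\<epsilon> * 3) = 1 / \<theta>"
        using \<theta> by (simp add: \<epsilon>_def exp_minus inverse_eq_divide)
      finally have e: "exp (\<epsilon> * (f (1 - (cmod x)\<^sup>2) - f (1 - R\<^sup>2))) \<le> 1 / \<theta>" .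
      have "q x * exp (\<epsilon> * (f (1 - (cmod x)\<^sup>2) - f (1 - R\<^sup>2))) \<le> \<theta> * (1 / \<theta>)"
        by (intro mult_mono e \<theta>(3) 2) (use \<theta>(1) in simp_all)
      with \<theta> show ?thesis by simp
    qed
  next
    fix x :: complex
    assume x: "x \<in> ball 0 R - cball 0 (9 / 10)" "0 < \<epsilon> * (f (1 - (cmod x)\<^sup>2) - f (1 - R\<^sup>2))"
    define s where "s = 1 - (cmod x)\<^sup>2"
    \<comment> \<open>The radius \<open>9 / 10\<close> gives \<open>s \<le> 19 / 100\<close>, within
      the range \<open>s \<le> 2 / 9\<close> of \<open>barrier_inequality\<close>.\<close>
    have "(9 / 10)\<^sup>2 \<le> (cmod x)\<^sup>2"
      using x by (intro power_mono) auto
    moreover have "(cmod x)\<^sup>2 < 1"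
      using x R by (simp add: power_less_one_iff)
    ultimately have s: "0 < s" "s \<le> 2 / 9"
      by (auto simp: s_def power2_eq_square)
    have "has_laplacian (\<lambda>z. \<epsilon> * (f (1 - (cmod (z - 0))\<^sup>2) - f (1 - R\<^sup>2))) x
        (4 * (cmod (x - 0))\<^sup>2 * (\<epsilon> * f2 s) + 4 * (- \<epsilon> * f1 (1 - (cmod (x - 0))\<^sup>2)))"
    proof (rule has_laplacian_radial)
      have "\<forall>\<^sub>F \<rho> in nhds ((cmod (x - 0))\<^sup>2). \<rho> \<in> {..<1}"
        using s by (intro eventually_nhds_in_open) (auto simp: s_def)
      then show "\<forall>\<^sub>F \<rho> in nhds ((cmod (x - 0))\<^sup>2).
          ((\<lambda>\<rho>. \<epsilon> * (f (1 - \<rho>) - f (1 - R\<^sup>2))) has_real_derivative - \<epsilon> * f1 (1 - \<rho>)) (at \<rho>)"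
      proof eventually_elim
        case (elim \<rho>)
        then show ?case
          by (auto intro!: derivative_eq_intros DERIV_chain2[OF f(1)])
      qed
      show "((\<lambda>\<rho>. - \<epsilon> * f1 (1 - \<rho>)) has_real_derivative \<epsilon> * f2 s) (at ((cmod (x - 0))\<^sup>2))"
        using s by (auto intro!: derivative_eq_intros DERIV_chain2[OF f(2)] simp: s_def)
    qed
    then have "has_laplacian (\<lambda>z. \<epsilon> * (f (1 - (cmod z)\<^sup>2) - f (1 - R\<^sup>2))) x
        (4 * \<epsilon> * ((1 - s) * f2 s - f1 s))"
      by (simp add: s_def algebra_simps)
    moreover have "2 * (c / (1 - (cmod x)\<^sup>2)\<^sup>2) * (\<epsilon> * (f (1 - (cmod x)\<^sup>2) - f (1 - R\<^sup>2)))
        \<le> 4 * \<epsilon> * ((1 - s) * f2 s - f1 s)"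
    proof -
      \<comment> \<open>The constant shift does not affect the Laplacian, and dropping it only
        enlarges the side to be bounded.\<close>
      have "2 * (c / s\<^sup>2) * (\<epsilon> * (f s - f (1 - R\<^sup>2))) \<le> 2 * (c / s\<^sup>2) * (\<epsilon> * f s)"
        using f0[of "1 - R\<^sup>2"] \<epsilon> c by (intro mult_left_mono) auto
      also have "\<dots> = 4 * \<epsilon> * (a * f s / s\<^sup>2)"
        by (simp add: a)
      also have "\<dots> \<le> 4 * \<epsilon> * ((1 - s) * f2 s - f1 s)"
        unfolding f_def f1_def f2_def
        using barrier_inequality[OF a(1) s] \<epsilon> by (intro mult_left_mono) auto
      finally show ?thesis by (simp add: s_def)
    qed
    ultimately show "\<exists>L. has_laplacian (\<lambda>z. \<epsilon> * (f (1 - (cmod z)\<^sup>2) - f (1 - R\<^sup>2))) x L \<and>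
        2 * (c / (1 - (cmod x)\<^sup>2)\<^sup>2) * (\<epsilon> * (f (1 - (cmod x)\<^sup>2) - f (1 - R\<^sup>2))) \<le> L"
      by blast
  qed
  have "q z \<le> exp (- \<epsilon> * (1 - (cmod z)\<^sup>2) powr (c / 2))" if z: "9 / 10 \<le> cmod z" "cmod z < 1" for z
  proof -
    define s where "s = 1 - (cmod z)\<^sup>2"
    have "((\<lambda>R. f (1 - R\<^sup>2)) \<longlongrightarrow> 0) (at_left 1)"
    proof -
      have "\<forall>\<^sub>F R::real in at_left 1. 0 \<le> 1 - R\<^sup>2"
        using eventually_at_left_real[of 0 1]
        by (rule eventually_mono) (auto intro!: power_le_one)
      then have "((\<lambda>R. f (1 - R\<^sup>2)) \<longlongrightarrow> (1 - 1\<^sup>2) powr a + 2 * (1 - 1\<^sup>2) powr (a + 1)) (at_left 1)"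
        unfolding f_def using a by (intro tendsto_intros tendsto_powr') auto
      then show ?thesis by simp
    qed
    then have "((\<lambda>R. q z * exp (\<epsilon> * (f s - f (1 - R\<^sup>2)))) \<longlongrightarrow> q z * exp (\<epsilon> * (f s - 0))) (at_left 1)"
      by (intro tendsto_intros)
    moreover have "\<forall>\<^sub>F R in at_left 1. q z * exp (\<epsilon> * (f s - f (1 - R\<^sup>2))) \<le> 1"
      using eventually_at_left_real[OF z(2)]
      by (rule eventually_mono) (use comp[OF z(1)] in \<open>auto simp: s_def\<close>)
    ultimately have "q z * exp (\<epsilon> * (f s - 0)) \<le> 1"
      by (rule tendsto_upperbound) simp
    then have "q z \<le> exp (- (\<epsilon> * f s))"
      by (simp add: exp_minus field_simps)
    \<comment> \<open>The correction term \<open>2 * s powr (a + 1)\<close> is nonnegative and can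
      be discarded here.\<close>
    also have "\<dots> \<le> exp (- \<epsilon> * s powr (c / 2))"
      using \<epsilon> by (simp add: f_def a_def)
    finally show ?thesis by (simp add: s_def)
  qed
  with \<epsilon> show ?thesis by (rule that)
qed

section \<open>Contradiction between boundary decay and the behaviour along the sequence\<close>

theorem theorem3p2:
  fixes lam mu kappa :: "complex \<Rightarrow> real" and c :: real and z :: "nat \<Rightarrow> complex"
  assumes "conformal_pseudometric (ball 0 1) lam"
    and "conformal_pseudometric (ball 0 1) mu"
    and "locally_Holder_on (ball 0 1) kappa"
    and "c > 0"
    and "\<And>w. w \<in> ball 0 1 \<Longrightarrow> - c \<le> kappa w \<and> kappa w \<le> - 4"
    and "\<And>w. w \<in> ball 0 1 \<Longrightarrow> mu w > 0 \<Longrightarrow> curvature mu w = kappa w"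
    and "dominated_on (ball 0 1) lam mu"
    and "\<And>n. z n \<in> ball 0 1"
    and "(\<lambda>n. norm (z n)) \<longlonglongrightarrow> 1"
    and "(\<lambda>n. quotient_ext (ball 0 1) lam mu (z n) - 1) \<in> o(\<lambda>n. (1 - norm (z n)) powr (c / 2))"
  shows "\<forall>w\<in>ball 0 1. lam w = mu w"
proof -
  obtain q where q: "is_quotient_extension (ball 0 1) lam mu q"
    using assms(7) by (auto simp: dominated_on_def)
  have c: "4 \<le> c"
    using assms(5)[of 0] by simp
  have pos: "0 < 1 - (cmod w)\<^sup>2" if "w \<in> ball 0 1" for w
    using that by (simp add: power_less_one_iff)
  have dom: "dominated_pair (ball 0 1) lam mu q (\<lambda>z. c / (1 - (cmod z)\<^sup>2)\<^sup>2)"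
  proof
    fix w assume w: "w \<in> ball (0::complex) 1"
    show "0 < c / (1 - (cmod w)\<^sup>2)\<^sup>2"
      using pos[OF w] assms(4) by simp
    assume "0 < mu w"
    then have k: "- c \<le> curvature mu w" "curvature mu w \<le> - 4"
      using assms(5,6) w by auto
    \<comment> \<open>Ahlfors' lemma uses \<open>kappa \<le> - 4\<close>; the lower bound
      \<open>- c\<close> then turns it into the majorant \<open>c / (1 - |w|^2)^2\<close>.\<close>
    have "mu w \<le> 1 / (1 - (cmod w)\<^sup>2)"
      using assms(5,6) by (intro pseudometric_le_hyperbolic[OF assms(2) _ w]) auto
    then have "(mu w)\<^sup>2 \<le> (1 / (1 - (cmod w)\<^sup>2))\<^sup>2"
      using \<open>0 < mu w\<close> by (intro power_mono) auto
    then have "- curvature mu w * (mu w)\<^sup>2 \<le> c * (1 / (1 - (cmod w)\<^sup>2))\<^sup>2"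
      using k assms(4) by (intro mult_mono) auto
    with k show "curvature mu w \<le> 0 \<and> - curvature mu w * (mu w)\<^sup>2 \<le> c / (1 - (cmod w)\<^sup>2)\<^sup>2"
      by (simp add: power_divide)
  qed (use assms q in \<open>auto simp: dominated_on_def\<close>)
  interpret dominated_pair "ball 0 1" lam mu q "\<lambda>z. c / (1 - (cmod z)\<^sup>2)\<^sup>2"
    by (rule dom)
  have "q w = 1" if w: "w \<in> ball 0 1" for w
  proof (rule ccontr)
    assume "q w \<noteq> 1"
    then have "q w < 1"
      using q_range[OF w] by simp
    moreover have "continuous_on (ball 0 1) (\<lambda>z. c / (1 - (cmod z)\<^sup>2)\<^sup>2)"
      using pos by (intro continuous_intros) fastforce
    ultimately have less: "q x < 1" if "x \<in> ball 0 1" for x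
      using quotient_less_one w that by blast
    obtain \<epsilon> where \<epsilon>: "0 < \<epsilon>"
      "\<And>z. 9 / 10 \<le> cmod z \<Longrightarrow> cmod z < 1 \<Longrightarrow> q z \<le> exp (- \<epsilon> * (1 - (cmod z)\<^sup>2) powr (c / 2))"
      using quotient_boundary_decay[OF dom c less] by blast
    \<comment> \<open>For \<open>0 < x \<le> \<epsilon>\<close> one has
      \<open>1 - exp (- x) \<ge> x / (1 + x) \<ge> x / (1 + \<epsilon>)\<close>. With
      \<open>x = \<epsilon> * (1 - |z|^2) powr (c / 2)\<close> this makes \<open>k\<close> the
      constant in the linear lower bound for \<open>1 - q\<close>.\<close>
    define k where "k = \<epsilon> / (1 + \<epsilon>)"
    have k: "0 < k" using \<epsilon> by (simp add: k_def)
    \<comment> \<open>A single instance of the little-o condition suffices; the constant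
      \<open>k / 2\<close> lies strictly below the lower bound \<open>k\<close>.\<close>
    have "\<forall>\<^sub>F n in sequentially. norm (quotient_ext (ball 0 1) lam mu (z n) - 1)
        \<le> k / 2 * norm ((1 - norm (z n)) powr (c / 2))"
      using landau_o.smallD[OF assms(10), of "k / 2"] k by simp
    moreover have "\<forall>\<^sub>F n in sequentially. 9 / 10 < norm (z n)"
      using assms(9) by (rule order_tendstoD) simp
    ultimately have "\<forall>\<^sub>F n in sequentially. False"
    proof eventually_elim
      case (elim n)
      have zn: "cmod (z n) < 1" "9 / 10 \<le> cmod (z n)"
        using assms(8)[of n] elim by auto
      define x where "x = \<epsilon> * (1 - (cmod (z n))\<^sup>2) powr (c / 2)"
      have s: "0 < 1 - (cmod (z n))\<^sup>2" "1 - (cmod (z n))\<^sup>2 \<le> 1"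
        using pos[OF assms(8)] by auto
      have "x \<le> \<epsilon> * 1"
        unfolding x_def using \<epsilon> powr_mono2[of "c / 2" "1 - (cmod (z n))\<^sup>2" 1] s c
        by (intro mult_left_mono) auto
      moreover have x: "0 < x"
        unfolding x_def using \<epsilon> s by simp
      ultimately have "x / (1 + \<epsilon>) \<le> x / (1 + x)"
        by (intro divide_left_mono) auto
      also have "\<dots> = 1 - 1 / (1 + x)"
        using x by (simp add: field_simps)
      also have "\<dots> \<le> 1 - exp (- x)"
        using x exp_ge_add_one_self[of x] by (simp add: exp_minus field_simps)
      also have "\<dots> \<le> 1 - q (z n)"
        using \<epsilon>(2)[OF zn(2,1)] by (simp add: x_def)
      finally have "k * (1 - (cmod (z n))\<^sup>2) powr (c / 2) \<le> 1 - q (z n)"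
        by (simp add: k_def x_def)
      \<comment> \<open>The decay estimate is in terms of \<open>1 - |z|^2\<close>, the hypothesis
        in terms of the smaller \<open>1 - |z|\<close>.\<close>
      moreover have "(1 - cmod (z n)) powr (c / 2) \<le> (1 - (cmod (z n))\<^sup>2) powr (c / 2)"
        using zn c by (intro powr_mono2) (auto simp: power2_eq_square mult_left_le)
      then have "k * (1 - cmod (z n)) powr (c / 2) \<le> k * (1 - (cmod (z n))\<^sup>2) powr (c / 2)"
        using k by (intro mult_left_mono) auto
      moreover have "1 - q (z n) \<le> k / 2 * (1 - cmod (z n)) powr (c / 2)"
        using elim quotient_ext_eq[OF open_ball assms(7) q assms(8)[of n]]
          q_range[OF assms(8)[of n]] by simp
      moreover have "0 < k * (1 - cmod (z n)) powr (c / 2)"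
        using k zn by simp
      ultimately show False by simp
    qed
    then show False by simp
  qed
  then show ?thesis
    using lam_eq_q_mult_mu by simp
qed

end
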